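(* For every fixed $d\in\mathbb N$, $N_{[]}(d,\delta)=(1+o_d(1))\delta^{-d}$ as $\delta\downarrow0$. Equivalently, \[ \lim_{\delta\downarrow0}\delta^d N_{[]}(d,\delta)=1 . \]
   Context: For $\boldsymbol x=(x_1,\dots,x_d)\in[0,1]^d$ put $V(\boldsymbol x)=\prod_{j=1}^d x_j$; $\boldsymbol x\le\boldsymbol y$ means $x_j\le y_j$ for all $j$. If $\boldsymbol x\le\boldsymbol y$ in $[0,1]^d$, the box $[\boldsymbol x,\boldsymbol y]=\prod_{j=1}^d[x_j,y_j]$ is a $\delta$-bracket when $V(\boldsymbol y)-V(\boldsymbol x)\le\delta$. A $\delta$-bracketing cover is a finite family of $\delta$-brackets whose union is $[0,1]^d$; $N_{[]}(d,\delta)$ is its minimum possible cardinality. The notation $o_d(1)$ denotes a quantity tending to $0$ as $\delta\downarrow0$ with $d$ fixed. *)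

theory Defs
  imports "HOL-Analysis.Analysis"
begin

text \<open>Points of \<open>\<real>\<^sup>d\<close> are extensional functions on the index set \<open>{..<d}\<close>, so that \<open>d\<close> is an
  ordinary natural number; coordinates are numbered \<open>0, \<dots>, d - 1\<close>.\<close>

definition unit_cube :: "nat \<Rightarrow> (nat \<Rightarrow> real) set" where
  "unit_cube d = (\<Pi>\<^sub>E j\<in>{..<d}. {0..1})"

definition V :: "nat \<Rightarrow> (nat \<Rightarrow> real) \<Rightarrow> real" where
  "V d x = (\<Prod>j<d. x j)"

definition closed_box :: "nat \<Rightarrow> (nat \<Rightarrow> real) \<Rightarrow> (nat \<Rightarrow> real) \<Rightarrow> (nat \<Rightarrow> real) set" where
  "closed_box d x y = (\<Pi>\<^sub>E j\<in>{..<d}. {x j..y j})"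

text \<open>A box with \<open>x \<le> y\<close> is nonempty and hence determines its corners, so brackets can be
  represented by the boxes themselves.\<close>

definition is_bracket :: "nat \<Rightarrow> real \<Rightarrow> (nat \<Rightarrow> real) set \<Rightarrow> bool" where
  "is_bracket d \<delta> B \<longleftrightarrow>
     (\<exists>x\<in>unit_cube d. \<exists>y\<in>unit_cube d.
        (\<forall>j<d. x j \<le> y j) \<and> V d y - V d x \<le> \<delta> \<and> B = closed_box d x y)"

definition is_bracketing_cover :: "nat \<Rightarrow> real \<Rightarrow> (nat \<Rightarrow> real) set set \<Rightarrow> bool" where
  "is_bracketing_cover d \<delta> \<B> \<longleftrightarrow>
     finite \<B> \<and> (\<forall>B\<in>\<B>. is_bracket d \<delta> B) \<and> \<Union>\<B> = unit_cube d"

text \<open>Meaningful for \<open>\<delta> > 0\<close>, where a cover always exists (take a sufficiently fine grid); if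
  there were no cover, \<open>LEAST\<close> would be an unspecified number.\<close>

definition bracketing_number :: "nat \<Rightarrow> real \<Rightarrow> nat" where
  "bracketing_number d \<delta> = (LEAST n. \<exists>\<B>. is_bracketing_cover d \<delta> \<B> \<and> card \<B> = n)"

end

theory Submission
  imports Defs "HOL-Real_Asymp.Real_Asymp"
begin

text \<open>
  In suitable coordinates, the largest volume of a $\delta$-bracket is exactly $\delta^d$. Let
  $d \ge 1$ and substitute $u_j = x_j^d$. The cube is mapped onto itself, $V$ becomes the geometric mean
  $G(u) = \prod_j u_j^{1/d}$, and $G$ is superadditive on the nonnegative orthant
  (Minkowski's inequality, a consequence of AM-GM). Hence for a bracket with corners $x \le y$,
  \[ \prod_j (y_j^d - x_j^d)^{1/d} \le V(y) - V(x) \le \delta , \]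
  so in the $u$-coordinates a $\delta$-bracket has volume at most $\delta^d$. As the images of the
  brackets of a cover still cover a cube of volume $1$, every cover has at least $\delta^{-d}$
  elements, for every $\delta > 0$ (lemma \<open>bracketing_cover_card_ge\<close>).

  Equality in Minkowski's inequality is attained when $x$ and $y$ are proportional, which suggests
  cells that are cubes in the coordinates $t_j = - \ln x_j$. In these coordinates
  $V = \exp(-\sum_j t_j)$, so a cube of side $s$ whose corner nearest to the origin is $t$ is a
  bracket of width $e^{-\sum t_j} (1 - e^{-ds}) \le e^{-\sum t_j} d s$, and the permitted side
  grows as $V$ decreases. All points with a coordinate at most $\delta$ are covered by $d$
  brackets that start at the origin, a number that $\delta^d$ makes negligible. The rest is the
  cube $[0, \ln(1/\delta)]^d$ of $t$-space. Cut it into $K^d$ blocks of side $L = \ln(1/\delta)/K$,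
  and cut the block with index $k$ into $n_k^d$ equal cubes, where
  $n_k = \lceil d L e^{-L \sum k_j} / \delta \rceil$ (lemma \<open>unit_cube_covered_by_log_grid\<close>).
  Without the rounding, $\delta^d \sum_k n_k^d$ would be a $d$-fold product of geometric sums and
  at most $(dL / (1 - e^{-dL}))^d$, which tends to $1$ as $L \to 0$. The rounding contributes
  $O(K^d \delta)$, because there are only $K^d$ blocks
  (lemma \<open>log_grid_size_le\<close>). The choice $K \approx (\ln \delta)^2$ makes both $L$ and
  $K^d \delta$ tend to $0$.
\<close>

section \<open>Minkowski's inequality for brackets\<close>

text \<open>The inequality of arithmetic and geometric means: after scaling to mean $1$, multiply the
  inequalities $c_j \le e^{c_j - 1}$; the exponents add up to $0$.\<close>

lemma prod_le_mean_power:
  fixes c :: "'a \<Rightarrow> real"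
  assumes "finite A" "A \<noteq> {}" and c: "\<And>j. j \<in> A \<Longrightarrow> 0 \<le> c j"
  shows "(\<Prod>j\<in>A. c j) \<le> ((\<Sum>j\<in>A. c j) / card A) ^ card A"
proof -
  define m where "m = (\<Sum>j\<in>A. c j) / card A"
  have card: "card A > 0"
    using assms by (simp add: card_gt_0_iff)
  have "m \<ge> 0"
    unfolding m_def by (intro divide_nonneg_nonneg sum_nonneg c) auto
  show ?thesis
  proof (cases "m = 0")
    case True
    with card have "(\<Sum>j\<in>A. c j) = 0"
      by (simp add: m_def)
    with assms have "\<forall>j\<in>A. c j = 0"
      by (simp add: sum_nonneg_eq_0_iff)
    with assms card show ?thesis
      by (simp add: prod_zero_iff)
  next
    case False
    with \<open>m \<ge> 0\<close> have m: "m > 0"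
      by simp
    have "(\<Prod>j\<in>A. c j / m) \<le> (\<Prod>j\<in>A. exp (c j / m - 1))"
      using m exp_ge_add_one_self[of "c _ / m - 1"] by (intro prod_mono conjI) (auto simp: c)
    also have "\<dots> = exp (\<Sum>j\<in>A. c j / m - 1)"
      using assms(1) by (simp add: exp_sum)
    also have "(\<Sum>j\<in>A. c j / m - 1) = (\<Sum>j\<in>A. c j) / m - card A"
      by (simp add: sum_subtractf sum_divide_distrib)
    also have "\<dots> = 0"
      using card m by (simp add: m_def field_simps)
    finally have "(\<Prod>j\<in>A. c j) / m ^ card A \<le> 1"
      by (simp add: prod_dividef)
    with m show ?thesis
      by (simp add: m_def[symmetric] divide_le_eq)
  qed
qed

text \<open>With $r_j = x_j / y_j$, AM-GM for the numbers $r_j^d$ and for the numbers $1 - r_j^d$ gives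
  $\prod_j r_j \le m$ and $\prod_j (1 - r_j^d) \le (1 - m)^d$ with the same mean $m$, and $m$ can
  be eliminated. Coordinates with $y_j = 0$ cannot be normalised, but then both sides vanish.\<close>

lemma prod_diff_power_le:
  fixes x y :: "nat \<Rightarrow> real"
  assumes d: "d > 0" and xy: "\<And>j. j < d \<Longrightarrow> 0 \<le> x j \<and> x j \<le> y j"
  shows "(\<Prod>j<d. y j ^ d - x j ^ d) \<le> (V d y - V d x) ^ d"
proof (cases "\<exists>j<d. y j = 0")
  case True
  then obtain i where i: "i < d" "y i = 0"
    by blast
  with xy[of i] have "x i = 0"
    by simp
  with i d have zero: "(\<Prod>j<d. y j ^ d - x j ^ d) = 0" "V d x = 0" "V d y = 0"
    by (auto simp: V_def prod_zero_iff power_0_left intro!: bexI[of _ i])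
  show ?thesis
    unfolding zero using d by simp
next
  case False
  with xy have y: "y j > 0" if "j < d" for j
    using that by (metis order.trans order_le_less)
  define r where "r j = x j / y j" for j
  define p where "p = (\<Prod>j<d. r j)"
  define m where "m = (\<Sum>j<d. r j ^ d) / d"
  have r: "0 \<le> r j" "r j \<le> 1" if "j < d" for j
    using xy[OF that] y[OF that] by (auto simp: r_def divide_le_eq)
  have p: "0 \<le> p"
    unfolding p_def by (intro prod_nonneg) (auto simp: r)
  have m: "0 \<le> m"
    unfolding m_def by (intro divide_nonneg_nonneg sum_nonneg zero_le_power) (auto simp: r)
  have "(\<Prod>j<d. r j ^ d) \<le> m ^ d"
    using prod_le_mean_power[of "{..<d}" "\<lambda>j. r j ^ d"] d r by (auto simp: m_def)
  then have "p ^ d \<le> m ^ d"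
    by (simp add: p_def prod_power_distrib)
  with m d have "p \<le> m"
    using power_mono_iff[of p m d] p by auto
  have mean: "(\<Sum>j<d. 1 - r j ^ d) / d = 1 - m"
    using d by (simp add: m_def sum_subtractf diff_divide_distrib)
  have m1: "0 \<le> 1 - m"
    unfolding mean[symmetric] using r by (intro divide_nonneg_nonneg sum_nonneg) (auto simp: power_le_one)
  have "(\<Prod>j<d. 1 - r j ^ d) \<le> (1 - m) ^ d"
    using prod_le_mean_power[of "{..<d}" "\<lambda>j. 1 - r j ^ d"] d r mean by (auto simp: power_le_one)
  also have "\<dots> \<le> (1 - p) ^ d"
    using \<open>p \<le> m\<close> m1 by (intro power_mono) auto
  finally have le: "(\<Prod>j<d. 1 - r j ^ d) \<le> (1 - p) ^ d" .
  have "(\<Prod>j<d. y j ^ d - x j ^ d) = (\<Prod>j<d. y j ^ d * (1 - r j ^ d))"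
  proof (intro prod.cong refl)
    show "y j ^ d - x j ^ d = y j ^ d * (1 - r j ^ d)" if "j \<in> {..<d}" for j
      using y[of j] that by (simp add: r_def power_divide field_simps)
  qed
  also have "\<dots> = V d y ^ d * (\<Prod>j<d. 1 - r j ^ d)"
    by (simp add: prod.distrib V_def prod_power_distrib)
  also have "\<dots> \<le> V d y ^ d * (1 - p) ^ d"
    by (intro mult_left_mono le zero_le_power)
      (auto simp: V_def intro!: prod_nonneg order_less_imp_le[OF y])
  also have "\<dots> = (V d y - V d x) ^ d"
  proof -
    have "V d y * p = V d x"
      unfolding V_def p_def prod.distrib[symmetric]
    proof (intro prod.cong refl)
      show "y j * r j = x j" if "j \<in> {..<d}" for j
        using y[of j] that by (simp add: r_def)
    qed
    then show ?thesis
      by (simp add: power_mult_distrib[symmetric] right_diff_distrib)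
  qed
  finally show ?thesis .
qed

section \<open>The lower bound\<close>

lemma emeasure_closed_box:
  assumes "\<And>j. j < d \<Longrightarrow> x j \<le> y j"
  shows "emeasure (\<Pi>\<^sub>M j\<in>{..<d}. lborel) (closed_box d x y) = ennreal (\<Prod>j<d. y j - x j)"
proof -
  interpret product_sigma_finite "\<lambda>_::nat. lborel :: real measure" ..
  have "emeasure (\<Pi>\<^sub>M j\<in>{..<d}. lborel) (closed_box d x y) = (\<Prod>j<d. ennreal (y j - x j))"
    unfolding closed_box_def using assms by (subst emeasure_PiM) auto
  also have "\<dots> = ennreal (\<Prod>j<d. y j - x j)"
    using assms by (intro prod_ennreal) auto
  finally show ?thesis .
qed

lemma closed_box_measurable: "closed_box d x y \<in> sets (\<Pi>\<^sub>M j\<in>{..<d}. lborel)"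
  unfolding closed_box_def by (intro sets_PiM_I_finite) auto

text \<open>The inverse of the substitution $u_j = x_j^d$. Preimages under it are used to transport
  sets to the $u$-coordinates, since a preimage of a cover is again a cover.\<close>

definition root_map :: "nat \<Rightarrow> (nat \<Rightarrow> real) \<Rightarrow> nat \<Rightarrow> real" where
  "root_map d u = (\<lambda>j\<in>{..<d}. root d (u j))"

lemma root_map_preimage_closed_box:
  assumes d: "d > 0" and x: "x \<in> unit_cube d" and y: "y \<in> unit_cube d"
  shows "{u \<in> unit_cube d. root_map d u \<in> closed_box d x y} =
         closed_box d (\<lambda>j. x j ^ d) (\<lambda>j. y j ^ d)"
proof (intro set_eqI iffI)
  fix u assume "u \<in> {u \<in> unit_cube d. root_map d u \<in> closed_box d x y}"
  then have u: "u \<in> unit_cube d" and box: "root_map d u \<in> closed_box d x y"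
    by auto
  have "x j ^ d \<le> u j \<and> u j \<le> y j ^ d" if j: "j < d" for j
  proof -
    have "x j \<le> root d (u j)" "root d (u j) \<le> y j"
      using box j by (auto simp: root_map_def closed_box_def PiE_iff)
    moreover have "0 \<le> x j" "0 \<le> u j"
      using x u j by (auto simp: unit_cube_def PiE_iff)
    ultimately have "x j ^ d \<le> root d (u j) ^ d" "root d (u j) ^ d \<le> y j ^ d"
      using power_mono[of "x j" "root d (u j)" d] power_mono[of "root d (u j)" "y j" d] by auto
    then show ?thesis
      using d \<open>0 \<le> u j\<close> by simp
  qed
  then show "u \<in> closed_box d (\<lambda>j. x j ^ d) (\<lambda>j. y j ^ d)"
    using u by (auto simp: closed_box_def unit_cube_def PiE_iff)
next
  fix u assume u: "u \<in> closed_box d (\<lambda>j. x j ^ d) (\<lambda>j. y j ^ d)"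
  have "0 \<le> u j \<and> u j \<le> 1 \<and> x j \<le> root d (u j) \<and> root d (u j) \<le> y j" if j: "j < d" for j
  proof -
    have uj: "x j ^ d \<le> u j" "u j \<le> y j ^ d"
      using u j by (auto simp: closed_box_def PiE_iff)
    have xy: "0 \<le> x j" "0 \<le> y j" "y j \<le> 1"
      using x y j by (auto simp: unit_cube_def PiE_iff)
    have "0 \<le> u j"
      by (rule order.trans[OF zero_le_power uj(1)]) (rule xy(1))
    moreover have "u j \<le> 1"
      by (rule order.trans[OF uj(2) power_le_one]) (rule xy)+
    moreover have "root d (x j ^ d) \<le> root d (u j)" "root d (u j) \<le> root d (y j ^ d)"
      using d uj by simp_all
    ultimately show ?thesis
      using d xy uj by (simp add: real_root_power_cancel)
  qed
  then show "u \<in> {u \<in> unit_cube d. root_map d u \<in> closed_box d x y}"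
    using u by (auto simp: root_map_def closed_box_def unit_cube_def PiE_iff)
qed

lemma emeasure_root_map_preimage_bracket:
  assumes d: "d > 0" and B: "is_bracket d \<delta> B"
  defines "C \<equiv> {u \<in> unit_cube d. root_map d u \<in> B}"
  shows "C \<in> sets (\<Pi>\<^sub>M j\<in>{..<d}. lborel)"
    and "emeasure (\<Pi>\<^sub>M j\<in>{..<d}. lborel) C \<le> ennreal (\<delta> ^ d)"
proof -
  obtain x y where x: "x \<in> unit_cube d" and y: "y \<in> unit_cube d"
    and le: "\<And>j. j < d \<Longrightarrow> x j \<le> y j" and diff: "V d y - V d x \<le> \<delta>" and "B = closed_box d x y"
    using B unfolding is_bracket_def by blast
  then have C: "C = closed_box d (\<lambda>j. x j ^ d) (\<lambda>j. y j ^ d)"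
    unfolding C_def using root_map_preimage_closed_box[OF d x y] by simp
  then show "C \<in> sets (\<Pi>\<^sub>M j\<in>{..<d}. lborel)"
    by (simp add: closed_box_measurable)
  have x0: "0 \<le> x j" if "j < d" for j
    using x that by (auto simp: unit_cube_def PiE_iff)
  have "emeasure (\<Pi>\<^sub>M j\<in>{..<d}. lborel) C = ennreal (\<Prod>j<d. y j ^ d - x j ^ d)"
    unfolding C by (intro emeasure_closed_box power_mono le x0)
  also have "(\<Prod>j<d. y j ^ d - x j ^ d) \<le> (V d y - V d x) ^ d"
    by (intro prod_diff_power_le d conjI x0 le)
  also have "\<dots> \<le> \<delta> ^ d"
  proof (intro power_mono diff)
    show "0 \<le> V d y - V d x"
      unfolding V_def using x0 le by (auto intro!: prod_mono)
  qed
  finally show "emeasure (\<Pi>\<^sub>M j\<in>{..<d}. lborel) C \<le> ennreal (\<delta> ^ d)"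
    by (simp add: ennreal_leI)
qed

text \<open>Transported to the $u$-coordinates, the cover consists of sets of volume at most $\delta^d$,
  and it covers a cube of volume $1$.\<close>

lemma bracketing_cover_card_ge:
  assumes \<delta>: "\<delta> > 0" and cov: "is_bracketing_cover d \<delta> \<B>"
  shows "1 \<le> \<delta> ^ d * real (card \<B>)"
proof (cases "d = 0")
  case True
  have "\<B> \<noteq> {}"
    using cov True by (auto simp: is_bracketing_cover_def unit_cube_def)
  with cov True show ?thesis
    by (simp add: is_bracketing_cover_def Suc_le_eq card_gt_0_iff)
next
  case False
  then have d: "d > 0"
    by simp
  have fin: "finite \<B>" and un: "\<Union>\<B> = unit_cube d" and br: "\<And>B. B \<in> \<B> \<Longrightarrow> is_bracket d \<delta> B"
    using cov by (auto simp: is_bracketing_cover_def)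
  let ?M = "\<Pi>\<^sub>M j\<in>{..<d}. (lborel :: real measure)"
  define C where "C B = {u \<in> unit_cube d. root_map d u \<in> B}" for B
  have C: "C B \<in> sets ?M" "emeasure ?M (C B) \<le> ennreal (\<delta> ^ d)" if "B \<in> \<B>" for B
    unfolding C_def using emeasure_root_map_preimage_bracket[OF d br[OF that]] .
  have "root_map d u \<in> unit_cube d" if "u \<in> unit_cube d" for u
    using that d by (auto simp: root_map_def unit_cube_def PiE_iff)
  then have sub: "unit_cube d \<subseteq> (\<Union>B\<in>\<B>. C B)"
    using un by (fastforce simp: C_def)
  have "1 = emeasure ?M (closed_box d (\<lambda>_. 0) (\<lambda>_. 1))"
    by (subst emeasure_closed_box) auto
  also have "closed_box d (\<lambda>_. 0) (\<lambda>_. 1) = unit_cube d"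
    by (simp add: closed_box_def unit_cube_def)
  also have "emeasure ?M (unit_cube d) \<le> emeasure ?M (\<Union>B\<in>\<B>. C B)"
    using sub fin C(1) by (intro emeasure_mono sets.finite_UN) auto
  also have "\<dots> \<le> (\<Sum>B\<in>\<B>. emeasure ?M (C B))"
    using fin C(1) by (intro emeasure_subadditive_finite) auto
  also have "\<dots> \<le> (\<Sum>B\<in>\<B>. ennreal (\<delta> ^ d))"
    by (intro sum_mono C(2))
  also have "\<dots> = ennreal (\<delta> ^ d * real (card \<B>))"
    using \<delta> by (simp add: ennreal_mult ennreal_of_nat_eq_real_of_nat mult.commute)
  finally have "ennreal 1 \<le> ennreal (\<delta> ^ d * real (card \<B>))"
    by simp
  then show ?thesis
    using \<delta> by (subst (asm) ennreal_le_iff) auto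
qed

lemma bracketing_number_le_card:
  "is_bracketing_cover d \<delta> \<B> \<Longrightarrow> bracketing_number d \<delta> \<le> card \<B>"
  unfolding bracketing_number_def by (rule Least_le) blast

lemma bracketing_number_ge:
  assumes "\<delta> > 0" and cover: "is_bracketing_cover d \<delta> \<B>"
  shows "1 \<le> \<delta> ^ d * real (bracketing_number d \<delta>)"
proof -
  have "\<exists>\<B>'. is_bracketing_cover d \<delta> \<B>' \<and> card \<B>' = bracketing_number d \<delta>"
    unfolding bracketing_number_def by (rule LeastI_ex) (use cover in blast)
  then obtain \<B>' where "is_bracketing_cover d \<delta> \<B>'" "card \<B>' = bracketing_number d \<delta>"
    by blast
  with bracketing_cover_card_ge[OF assms(1)] show ?thesis
    by force
qed

section \<open>A cover by cubes in logarithmic coordinates\<close>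

text \<open>The number \<open>n k\<close> is the least one for which the cubes of side \<open>L / n k\<close> in the
  block \<open>k\<close> are brackets by the estimate $1 - e^{-s} \le s$ for $s = d L / n_k$. The
  factor \<open>exp (- L) ^ k j\<close> is the largest value of the coordinate \<open>j\<close> in that
  block, so their product bounds $V$ on it.\<close>

lemma unit_cube_covered_by_log_grid:
  fixes d K :: nat and \<delta> L :: real
  assumes d: "d > 0" and \<delta>: "0 < \<delta>" "\<delta> < 1" and K: "K > 0"
  defines "L \<equiv> ln (1 / \<delta>) / K"
  defines "n \<equiv> \<lambda>k :: nat \<Rightarrow> nat. nat \<lceil>d * L * (\<Prod>j<d. exp (- L) ^ k j) / \<delta>\<rceil>"
  shows "\<exists>\<B>. is_bracketing_cover d \<delta> \<B> \<and>
           card \<B> \<le> d + (\<Sum>k\<in>(\<Pi>\<^sub>E j\<in>{..<d}. {..<K}). n k ^ d)"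
proof -
  have L: "L > 0"
    using \<delta> K by (simp add: L_def)
  have LK: "exp (- (L * K)) = \<delta>"
    using \<delta> K by (simp add: L_def exp_minus ln_div)
  have n_pos: "n k > 0" for k
    using d L \<delta> by (simp add: n_def prod_pos)
  \<comment> \<open>The grid points of block \<open>k\<close>. Since \<open>exp (- t)\<close> decreases in \<open>t\<close>, the lower
    corner of a cell is the one with the indices \<open>Suc (m j)\<close>.\<close>
  define pt where "pt k m = (\<lambda>j\<in>{..<d}. exp (- (L * (real (k j) + real (m j) / n k))))"
    for k m :: "nat \<Rightarrow> nat"
  define cell where "cell k m = closed_box d (pt k (\<lambda>j. Suc (m j))) (pt k m)" for k m
  \<comment> \<open>The points whose coordinate \<open>i\<close> is at most \<open>\<delta>\<close>: a bracket because \<open>V\<close> is \<open>0\<close> at its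
    lower and \<open>\<delta>\<close> at its upper corner.\<close>
  define slab where "slab i = closed_box d (\<lambda>j\<in>{..<d}. 0) (\<lambda>j\<in>{..<d}. if j = i then \<delta> else 1)" for i
  define Ks where "Ks = (\<Pi>\<^sub>E j\<in>{..<d}. {..<K})"
  define Ms where "Ms k = (\<Pi>\<^sub>E j\<in>{..<d}. {..<n k})" for k :: "nat \<Rightarrow> nat"
  define \<B> where "\<B> = slab ` {..<d} \<union> (\<Union>k\<in>Ks. cell k ` Ms k)"
  have fin: "finite Ks" "finite (Ms k)" for k
    by (auto simp: Ks_def Ms_def intro!: finite_PiE)
  have slab: "is_bracket d \<delta> (slab i)" if "i < d" for i
    unfolding is_bracket_def
  proof (intro bexI conjI)
    have "V d (\<lambda>j\<in>{..<d}. if j = i then \<delta> else 1) = \<delta>"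
      using that by (simp add: V_def prod.delta)
    moreover have "V d (\<lambda>j\<in>{..<d}. 0) = 0"
      using d by (simp add: V_def)
    ultimately show "V d (\<lambda>j\<in>{..<d}. if j = i then \<delta> else 1) - V d (\<lambda>j\<in>{..<d}. 0) \<le> \<delta>"
      by simp
  qed (use \<delta> in \<open>auto simp: slab_def unit_cube_def\<close>)
  have pt_cube: "pt k m \<in> unit_cube d" for k m
    using L by (auto simp: pt_def unit_cube_def)
  have cell: "is_bracket d \<delta> (cell k m)" for k m
    unfolding is_bracket_def
  proof (intro bexI conjI pt_cube)
    show "\<forall>j<d. pt k (\<lambda>j. Suc (m j)) j \<le> pt k m j"
      using L n_pos[of k] by (auto simp: pt_def intro!: add_left_mono divide_right_mono)
    let ?v = "V d (pt k m)"
    have "V d (pt k (\<lambda>j. Suc (m j))) = (\<Prod>j<d. pt k m j * exp (- (L / n k)))"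
      unfolding V_def
      by (intro prod.cong) (auto simp: pt_def add_divide_distrib algebra_simps simp flip: exp_add)
    also have "\<dots> = ?v * exp (- (d * L / n k))"
      by (simp add: prod.distrib V_def exp_of_nat_mult[symmetric])
    finally have "?v - V d (pt k (\<lambda>j. Suc (m j))) = ?v * (1 - exp (- (d * L / n k)))"
      by (simp add: algebra_simps)
    also have "\<dots> \<le> (\<Prod>j<d. exp (- L) ^ k j) * (d * L / n k)"
    proof (intro mult_mono)
      show "?v \<le> (\<Prod>j<d. exp (- L) ^ k j)"
        unfolding V_def using L
        by (intro prod_mono) (auto simp: pt_def simp flip: exp_of_nat_mult simp: algebra_simps)
      show "1 - exp (- (d * L / n k)) \<le> d * L / n k"
        using exp_ge_add_one_self[of "- (d * L / n k)"] by simp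
    qed (use L in \<open>auto intro!: prod_nonneg\<close>)
    also have "\<dots> \<le> \<delta>"
    proof -
      have "d * L * (\<Prod>j<d. exp (- L) ^ k j) / \<delta> \<le> n k"
        unfolding n_def by linarith
      then show ?thesis
        using \<delta> n_pos[of k] by (simp add: field_simps)
    qed
    finally show "?v - V d (pt k (\<lambda>j. Suc (m j))) \<le> \<delta>" .
  qed (simp_all add: cell_def pt_cube)
  have "unit_cube d \<subseteq> \<Union>\<B>"
  proof
    fix x assume x: "x \<in> unit_cube d"
    then have x01: "0 \<le> x j" "x j \<le> 1" if "j < d" for j
      using that by (auto simp: unit_cube_def PiE_iff)
    show "x \<in> \<Union>\<B>"
    proof (cases "\<exists>i<d. x i \<le> \<delta>")
      case True
      then obtain i where "i < d" "x i \<le> \<delta>"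
        by blast
      then have "x \<in> slab i"
        using x x01 by (auto simp: slab_def closed_box_def unit_cube_def PiE_iff)
      with \<open>i < d\<close> show ?thesis
        by (auto simp: \<B>_def)
    next
      case False
      define t where "t j = - ln (x j) / L" for j
      define k where "k = (\<lambda>j\<in>{..<d}. nat \<lfloor>t j\<rfloor>)"
      define m where "m = (\<lambda>j\<in>{..<d}. nat \<lfloor>(t j - k j) * n k\<rfloor>)"
      have x_pos: "x j > \<delta>" if "j < d" for j
        using False that by force
      have x_t: "x j = exp (- (L * t j))" if "j < d" for j
        using x_pos[OF that] \<delta> L by (simp add: t_def)
      have t: "0 \<le> t j" "t j < K" if "j < d" for j
      proof -
        show "0 \<le> t j"
          using x_pos[OF that] \<delta> x01[OF that] L by (simp add: t_def divide_nonpos_pos)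
        have "exp (- (L * K)) < exp (- (L * t j))"
          using x_pos[OF that] by (simp add: LK x_t[OF that, symmetric])
        then show "t j < K"
          using L by simp
      qed
      have k: "k j \<le> t j" "t j < k j + 1" if "j < d" for j
        using t[OF that] that by (auto simp: k_def) linarith
      have "k j < K" if "j < d" for j
        using k(1)[OF that] t(2)[OF that] by linarith
      then have kK: "k \<in> Ks"
        by (auto simp: Ks_def k_def)
      have m: "m j \<le> (t j - k j) * n k" "(t j - k j) * n k < m j + 1" if "j < d" for j
        using k[OF that] that by (auto simp: m_def) linarith
      have "m j < n k" if "j < d" for j
      proof -
        have "m j \<le> (t j - k j) * n k"
          by (rule m[OF that])
        also have "\<dots> < 1 * real (n k)"
          using k[OF that] n_pos[of k] by (intro mult_strict_right_mono) auto
        finally show ?thesis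
          by simp
      qed
      then have mM: "m \<in> Ms k"
        by (auto simp: Ms_def m_def)
      have "x \<in> cell k m"
      proof -
        have "pt k (\<lambda>j. Suc (m j)) j \<le> x j \<and> x j \<le> pt k m j" if "j < d" for j
        proof -
          have "k j + m j / n k \<le> t j" "t j \<le> k j + Suc (m j) / n k"
            using m[OF that] n_pos[of k] by (simp_all add: field_simps)
          then show ?thesis
            using L that by (simp add: pt_def x_t)
        qed
        then show ?thesis
          using x by (auto simp: cell_def closed_box_def unit_cube_def PiE_iff)
      qed
      with kK mM show ?thesis
        by (auto simp: \<B>_def)
    qed
  qed
  moreover have "B \<subseteq> unit_cube d" if "is_bracket d \<delta> B" for B
    using that unfolding is_bracket_def
    by (auto simp: closed_box_def unit_cube_def PiE_iff) (meson lessThan_iff order.trans)+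
  moreover have "\<forall>B\<in>\<B>. is_bracket d \<delta> B"
    using slab cell by (auto simp: \<B>_def)
  moreover have "finite \<B>"
    using fin by (auto simp: \<B>_def)
  ultimately have cover: "is_bracketing_cover d \<delta> \<B>"
    unfolding is_bracketing_cover_def by blast
  have "card \<B> \<le> card (slab ` {..<d}) + card (\<Union>k\<in>Ks. cell k ` Ms k)"
    unfolding \<B>_def by (rule card_Un_le)
  also have "\<dots> \<le> d + (\<Sum>k\<in>Ks. n k ^ d)"
  proof (intro add_mono)
    show "card (slab ` {..<d}) \<le> d"
      using card_image_le[of "{..<d}" slab] by simp
    have "card (\<Union>k\<in>Ks. cell k ` Ms k) \<le> (\<Sum>k\<in>Ks. card (cell k ` Ms k))"
      using fin by (intro card_UN_le)
    also have "\<dots> \<le> (\<Sum>k\<in>Ks. card (Ms k))"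
      using fin by (intro sum_mono card_image_le)
    also have "\<dots> = (\<Sum>k\<in>Ks. n k ^ d)"
      by (simp add: Ms_def card_PiE)
    finally show "card (\<Union>k\<in>Ks. cell k ` Ms k) \<le> (\<Sum>k\<in>Ks. n k ^ d)" .
  qed
  finally show ?thesis
    using cover unfolding Ks_def by blast
qed

section \<open>The size of the cover\<close>

text \<open>An explicit mean value estimate for the power function; it isolates the effect of rounding
  one cell count up.\<close>

lemma power_add_le:
  fixes a b :: real
  assumes "0 \<le> a" "0 \<le> b"
  shows "(a + b) ^ d \<le> a ^ d + d * b * (a + b) ^ (d - 1)"
proof (induction d)
  case (Suc d)
  have "(a + b) ^ Suc d = a * (a + b) ^ d + b * (a + b) ^ d"
    by (simp add: algebra_simps)
  also have "\<dots> \<le> a * (a ^ d + d * b * (a + b) ^ (d - 1)) + b * (a + b) ^ d"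
    using assms Suc by (intro add_right_mono mult_left_mono)
  also have "\<dots> = a ^ Suc d + a * (d * b * (a + b) ^ (d - 1)) + b * (a + b) ^ d"
    by (simp add: algebra_simps)
  also have "\<dots> \<le> a ^ Suc d + d * b * (a + b) ^ d + b * (a + b) ^ d"
  proof (cases d)
    case (Suc e)
    have "d * b * (a * (a + b) ^ e) \<le> d * b * ((a + b) * (a + b) ^ e)"
      using assms by (intro mult_left_mono mult_right_mono) auto
    then show ?thesis
      by (simp add: Suc mult_ac)
  qed simp
  finally show ?case
    by (simp add: algebra_simps)
qed simp

text \<open>Rounding up changes $\delta n_k$ by at most $\delta$, so each of the $K^d$ blocks contributes
  an error of order $\delta$. The sum of the unrounded terms over all blocks factorises into
  $d$ equal geometric sums with ratio $q = e^{-dL}$.\<close>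

lemma log_grid_size_le:
  fixes K d :: nat and L \<delta> :: real
  assumes \<delta>: "0 < \<delta>" "\<delta> < 1" and L: "L > 0" and d: "d > 0"
  shows "\<delta> ^ d * (\<Sum>k\<in>(\<Pi>\<^sub>E j\<in>{..<d}. {..<K}). real (nat \<lceil>d * L * (\<Prod>j<d. exp (- L) ^ k j) / \<delta>\<rceil>) ^ d)
       \<le> (d * L / (1 - exp (- (d * L)))) ^ d + real K ^ d * (d * \<delta> * (d * L + 1) ^ (d - 1))"
proof -
  let ?Ks = "\<Pi>\<^sub>E j\<in>{..<d}. {..<K}"
  define a where "a k = d * L * (\<Prod>j<d. exp (- L) ^ k j)" for k :: "nat \<Rightarrow> nat"
  have a: "0 \<le> a k" "a k \<le> d * L" for k
  proof -
    show "0 \<le> a k"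
      using L by (auto simp: a_def intro!: mult_nonneg_nonneg prod_nonneg)
    have "(\<Prod>j<d. exp (- L) ^ k j) \<le> 1"
      using L by (intro prod_le_1) (auto simp: power_le_one)
    then show "a k \<le> d * L"
      using L d by (simp add: a_def)
  qed
  have "\<delta> ^ d * real (nat \<lceil>a k / \<delta>\<rceil>) ^ d \<le> a k ^ d + d * \<delta> * (d * L + 1) ^ (d - 1)" for k
  proof -
    have "a k / \<delta> \<ge> 0"
      using a \<delta> by simp
    then have "real (nat \<lceil>a k / \<delta>\<rceil>) \<le> a k / \<delta> + 1"
      by linarith
    then have "\<delta> * real (nat \<lceil>a k / \<delta>\<rceil>) \<le> a k + \<delta>"
      using \<delta> by (simp add: field_simps)
    then have "(\<delta> * real (nat \<lceil>a k / \<delta>\<rceil>)) ^ d \<le> (a k + \<delta>) ^ d"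
      using \<delta> by (intro power_mono) auto
    also have "\<dots> \<le> a k ^ d + d * \<delta> * (a k + \<delta>) ^ (d - 1)"
      using a \<delta> by (intro power_add_le) auto
    also have "\<dots> \<le> a k ^ d + d * \<delta> * (d * L + 1) ^ (d - 1)"
      using a \<delta> by (intro add_left_mono mult_left_mono power_mono add_mono) auto
    finally show ?thesis
      by (simp add: power_mult_distrib)
  qed
  then have "\<delta> ^ d * (\<Sum>k\<in>?Ks. real (nat \<lceil>a k / \<delta>\<rceil>) ^ d)
      \<le> (\<Sum>k\<in>?Ks. a k ^ d + d * \<delta> * (d * L + 1) ^ (d - 1))"
    unfolding sum_distrib_left by (intro sum_mono)
  also have "\<dots> = (\<Sum>k\<in>?Ks. a k ^ d) + real K ^ d * (d * \<delta> * (d * L + 1) ^ (d - 1))"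
    by (simp add: sum.distrib card_PiE)
  also have "(\<Sum>k\<in>?Ks. a k ^ d) \<le> (d * L / (1 - exp (- (d * L)))) ^ d"
  proof -
    define q where "q = exp (- (d * L))"
    have q: "0 < q" "q < 1"
      using L d by (auto simp: q_def)
    have pow: "(exp (- L) ^ i) ^ d = q ^ i" for i
      by (simp add: q_def algebra_simps flip: exp_of_nat_mult)
    have "a k ^ d = (d * L) ^ d * (\<Prod>j<d. q ^ k j)" for k
      unfolding a_def power_mult_distrib prod_power_distrib pow ..
    then have "(\<Sum>k\<in>?Ks. a k ^ d) = (d * L) ^ d * (\<Sum>k\<in>?Ks. \<Prod>j<d. q ^ k j)"
      by (simp add: sum_distrib_left)
    also have "(\<Sum>k\<in>?Ks. \<Prod>j<d. q ^ k j) = (\<Prod>j<d. \<Sum>i<K. q ^ i)"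
      by (rule prod_sum_PiE[symmetric]) auto
    also have "\<dots> = (\<Sum>i<K. q ^ i) ^ d"
      by simp
    also have "\<dots> \<le> (1 / (1 - q)) ^ d"
    proof (intro power_mono)
      show "(\<Sum>i<K. q ^ i) \<le> 1 / (1 - q)"
        using q by (simp add: sum_gp_strict divide_right_mono)
    qed (use q in \<open>auto intro: sum_nonneg\<close>)
    finally show ?thesis
      using L by (simp add: q_def power_mult_distrib power_divide mult_left_mono)
  qed
  finally show ?thesis
    by (simp add: a_def)
qed

lemma bracketing_number_bounds:
  fixes d K :: nat and \<delta> L :: real
  assumes d: "d > 0" and \<delta>: "0 < \<delta>" "\<delta> < 1" and K: "K > 0"
  defines "L \<equiv> ln (1 / \<delta>) / K"
  shows "1 \<le> \<delta> ^ d * real (bracketing_number d \<delta>)"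
    and "\<delta> ^ d * real (bracketing_number d \<delta>)
           \<le> d * \<delta> ^ d + ((d * L / (1 - exp (- (d * L)))) ^ d + real K ^ d * (d * \<delta> * (d * L + 1) ^ (d - 1)))"
proof -
  have L: "L > 0"
    using \<delta> K by (simp add: L_def)
  let ?n = "\<lambda>k. nat \<lceil>d * L * (\<Prod>j<d. exp (- L) ^ k j) / \<delta>\<rceil>"
  let ?Ks = "\<Pi>\<^sub>E j\<in>{..<d}. {..<K}"
  obtain \<B> where \<B>: "is_bracketing_cover d \<delta> \<B>" "card \<B> \<le> d + (\<Sum>k\<in>?Ks. ?n k ^ d)"
    using unit_cube_covered_by_log_grid[OF d \<delta> K] unfolding L_def by blast
  show "1 \<le> \<delta> ^ d * real (bracketing_number d \<delta>)"
    using \<delta>(1) \<B>(1) by (rule bracketing_number_ge)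
  have "bracketing_number d \<delta> \<le> card \<B>"
    using \<B>(1) by (rule bracketing_number_le_card)
  with \<B> have "real (bracketing_number d \<delta>) \<le> real (d + (\<Sum>k\<in>?Ks. ?n k ^ d))"
    by linarith
  then have "\<delta> ^ d * real (bracketing_number d \<delta>) \<le> \<delta> ^ d * real (d + (\<Sum>k\<in>?Ks. ?n k ^ d))"
    using \<delta> by (intro mult_left_mono) auto
  also have "\<dots> = d * \<delta> ^ d + \<delta> ^ d * (\<Sum>k\<in>?Ks. real (?n k) ^ d)"
    by (simp add: algebra_simps)
  also have "\<dots> \<le> d * \<delta> ^ d + ((d * L / (1 - exp (- (d * L)))) ^ d + real K ^ d * (d * \<delta> * (d * L + 1) ^ (d - 1)))"
    by (intro add_left_mono log_grid_size_le \<delta> L d)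
  finally show "\<delta> ^ d * real (bracketing_number d \<delta>)
      \<le> d * \<delta> ^ d + ((d * L / (1 - exp (- (d * L)))) ^ d + real K ^ d * (d * \<delta> * (d * L + 1) ^ (d - 1)))" .
qed

section \<open>The limit\<close>

text \<open>For $d = 0$ the cube is a single point, the empty product $V$ is $1$, and one bracket is
  needed.\<close>

lemma bracketing_number_0:
  assumes "\<delta> > 0"
  shows "bracketing_number 0 \<delta> = 1"
proof -
  have cover: "is_bracketing_cover 0 \<delta> {unit_cube 0}"
    using assms by (auto simp: is_bracketing_cover_def is_bracket_def closed_box_def unit_cube_def V_def)
  have "bracketing_number 0 \<delta> \<le> 1"
    using bracketing_number_le_card[OF cover] by simp
  moreover have "1 \<le> real (bracketing_number 0 \<delta>)"
    using bracketing_number_ge[OF assms cover] by simp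
  ultimately show ?thesis
    by simp
qed

lemma bracketing_number_tendsto:
  "((\<lambda>\<delta>::real. \<delta> ^ d * real (bracketing_number d \<delta>)) \<longlongrightarrow> 1) (at_right 0)"
proof (cases "d = 0")
  case True
  have "\<forall>\<^sub>F \<delta> in at_right 0. \<delta> ^ d * real (bracketing_number d \<delta>) = 1"
    using eventually_at_right_less[of "0::real"]
    by eventually_elim (simp add: True bracketing_number_0)
  then show ?thesis
    by (rule tendsto_eventually)
next
  case False
  then have d: "d > 0"
    by simp
  \<comment> \<open>The number of blocks per axis must grow faster than \<open>ln (1 / \<delta>)\<close>, so that \<open>L\<close>
    tends to \<open>0\<close>, but more slowly than every negative power of \<open>\<delta>\<close>.\<close>
  define K where "K \<delta> = nat \<lceil>(ln \<delta>)\<^sup>2\<rceil>" for \<delta> :: real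
  define L where "L \<delta> = ln (1 / \<delta>) / K \<delta>" for \<delta> :: real
  have unit: "\<forall>\<^sub>F \<delta>::real in at_right 0. 0 < \<delta> \<and> \<delta> < 1"
    by (rule eventually_at_rightI[of _ 1]) auto
  then have K: "\<forall>\<^sub>F \<delta>::real in at_right 0. 0 < K \<delta>"
    by eventually_elim (simp add: K_def)
  have L_pos: "\<forall>\<^sub>F \<delta>::real in at_right 0. 0 < L \<delta>"
    using unit K by eventually_elim (simp add: L_def)
  have L_lim: "(L \<longlongrightarrow> 0) (at_right 0)"
  proof (rule tendsto_sandwich)
    show "\<forall>\<^sub>F \<delta> in at_right 0. 0 \<le> L \<delta>"
      using L_pos by eventually_elim simp
    show "\<forall>\<^sub>F \<delta> in at_right 0. L \<delta> \<le> 1 / ln (1 / \<delta>)"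
      using unit K
    proof eventually_elim
      case (elim \<delta>)
      have "(ln (1 / \<delta>))\<^sup>2 \<le> K \<delta>"
        using elim by (simp add: K_def ln_div)
      then show ?case
        using elim by (simp add: L_def field_simps power2_eq_square)
    qed
    show "((\<lambda>\<delta>::real. 1 / ln (1 / \<delta>)) \<longlongrightarrow> 0) (at_right 0)"
      by real_asymp
  qed simp
  have L_at: "filterlim L (at_right 0) (at_right 0)"
    using L_lim L_pos by (auto simp: filterlim_at elim: eventually_mono)
  have ratio: "((\<lambda>\<delta>. d * L \<delta> / (1 - exp (- (d * L \<delta>)))) \<longlongrightarrow> 1) (at_right 0)"
  proof -
    have "((\<lambda>x::real. d * x / (1 - exp (- (d * x)))) \<longlongrightarrow> 1) (at_right 0)"
      using d by real_asymp
    from filterlim_compose[OF this L_at] show ?thesis .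
  qed
  have rounding: "((\<lambda>\<delta>. real (K \<delta>) ^ d * \<delta>) \<longlongrightarrow> 0) (at_right 0)"
  proof (rule tendsto_sandwich)
    show "\<forall>\<^sub>F \<delta> in at_right 0. 0 \<le> real (K \<delta>) ^ d * \<delta>"
      using unit by eventually_elim simp
    show "\<forall>\<^sub>F \<delta> in at_right 0. real (K \<delta>) ^ d * \<delta> \<le> ((ln \<delta>)\<^sup>2 + 1) ^ d * \<delta>"
      using unit
    proof eventually_elim
      case (elim \<delta>)
      have "0 \<le> (ln \<delta>)\<^sup>2"
        by simp
      then have "real (K \<delta>) \<le> (ln \<delta>)\<^sup>2 + 1"
        unfolding K_def by linarith
      with elim show ?case
        by (simp add: power_mono)
    qed
    show "((\<lambda>\<delta>::real. ((ln \<delta>)\<^sup>2 + 1) ^ d * \<delta>) \<longlongrightarrow> 0) (at_right 0)"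
      by real_asymp
  qed simp
  define f where "f \<delta> = real d * \<delta> ^ d + ((d * L \<delta> / (1 - exp (- (d * L \<delta>)))) ^ d +
      real (K \<delta>) ^ d * (d * \<delta> * (d * L \<delta> + 1) ^ (d - 1)))" for \<delta> :: real
  have "((\<lambda>\<delta>::real. real d * \<delta> ^ d + ((d * L \<delta> / (1 - exp (- (d * L \<delta>)))) ^ d +
      d * (d * L \<delta> + 1) ^ (d - 1) * (real (K \<delta>) ^ d * \<delta>))) \<longlongrightarrow> real d * 0 ^ d + (1 ^ d + real d * (real d * 0 + 1) ^ (d - 1) * 0)) (at_right 0)"
    by (intro tendsto_intros ratio L_lim rounding)
  then have f_lim: "(f \<longlongrightarrow> 1) (at_right 0)"
    using d by (simp add: f_def[abs_def] mult_ac power_0_left)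
  show ?thesis
  proof (rule tendsto_sandwich)
    show "\<forall>\<^sub>F \<delta> in at_right 0. 1 \<le> \<delta> ^ d * real (bracketing_number d \<delta>)"
      using unit K by eventually_elim (rule bracketing_number_bounds(1)[OF d], auto)
    show "\<forall>\<^sub>F \<delta> in at_right 0. \<delta> ^ d * real (bracketing_number d \<delta>) \<le> f \<delta>"
      using unit K
    proof eventually_elim
      case (elim \<delta>)
      then show ?case
        unfolding f_def L_def using bracketing_number_bounds(2)[OF d, of \<delta> "K \<delta>"] by simp
    qed
  qed (use f_lim in auto)
qed

theorem theorem1p2:
  fixes d :: nat
  shows "(\<exists>r :: real \<Rightarrow> real. (r \<longlongrightarrow> 0) (at_right 0) \<and>
            (\<forall>\<delta>>0. real (bracketing_number d \<delta>) = (1 + r \<delta>) * \<delta> powi (- int d)))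
         \<and> ((\<lambda>\<delta>::real. \<delta> ^ d * real (bracketing_number d \<delta>)) \<longlongrightarrow> 1) (at_right 0)"
proof (intro conjI exI allI impI)
  define r where "r \<delta> = \<delta> ^ d * real (bracketing_number d \<delta>) - 1" for \<delta> :: real
  show "(r \<longlongrightarrow> 0) (at_right 0)"
    using tendsto_diff[OF bracketing_number_tendsto[of d] tendsto_const[of 1]]
    by (simp add: r_def[abs_def])
  show "real (bracketing_number d \<delta>) = (1 + r \<delta>) * \<delta> powi (- int d)" if "\<delta> > 0" for \<delta> :: real
    using that by (simp add: r_def power_int_minus field_simps)
qed (rule bracketing_number_tendsto)

end
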